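(* Let $K=10$ and $\theta=\frac{\pi}{5}$. For $B>0$ define ten points in $\mathbb{R}^5$ by $$z_k(B)=\Big(\cos((k-1)\theta),\ \sin((k-1)\theta),\ \sqrt B\cos(2(k-1)\theta),\ \sqrt B\sin(2(k-1)\theta),\ 0\Big),\qquad k=1,\dots,10.$$ Then there exists $B_0\in(4.7,4.71)$ such that, taking $z_k=z_k(B_0)$ for $k=1,\dots,10$, there exist constants $a>b>0$ such that for every $t\in\mathbb{R}$ the numbers $$x_k(t)=a+b\cos\big(t+2(k-1)\theta\big),\qquad k=1,\dots,10,$$ satisfy $$6x_k(t)=\kappa\sum_{1\le j\le 10,\ j\ne k}|z_j-z_k|^{-3}x_j(t)^3,\qquad x_k(t)>0,\qquad k=1,\dots,10.$$
   Context: $\kappa>0$ is the constant $\kappa=\frac32\,15^{3/2}\,\frac{\int_{\mathbb{R}^5}W^{7/3}dx}{\|\Lambda W\|_{L^2}^2}$, where $W(x)=(1+|x|^2/15)^{-3/2}$ on $\mathbb{R}^5$ and $\Lambda W=\left(\frac32+x\cdot\nabla\right)W$. *)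

theory Defs
  imports "HOL-Analysis.Analysis"
begin

definition W :: "real^5 \<Rightarrow> real" where
  "W x = (1 + (norm x)\<^sup>2 / 15) powr (- (3/2))"

text \<open>The term \<open>x \<cdot> \<nabla>f(x)\<close> is the derivative of \<open>f\<close> at \<open>x\<close> in the direction \<open>x\<close>.\<close>

definition Lambda :: "(real^5 \<Rightarrow> real) \<Rightarrow> real^5 \<Rightarrow> real" where
  "Lambda f x = 3/2 * f x + frechet_derivative f (at x) x"

definition L2_norm :: "(real^5 \<Rightarrow> real) \<Rightarrow> real" where
  "L2_norm f = sqrt (LINT x|lborel. (f x)\<^sup>2)"

definition kappa :: real where
  "kappa = 3/2 * 15 powr (3/2) * ((LINT x|lborel. W x powr (7/3)) / (L2_norm (Lambda W))\<^sup>2)"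

definition theta :: real where
  "theta = pi / 5"

definition z :: "real \<Rightarrow> nat \<Rightarrow> real^5" where
  "z B k = vector [cos ((real k - 1) * theta), sin ((real k - 1) * theta),
                   sqrt B * cos (2 * (real k - 1) * theta),
                   sqrt B * sin (2 * (real k - 1) * theta), 0]"

lemma vector_5:
  fixes a b c d e :: "'a::zero"
  shows "(vector [a, b, c, d, e] :: 'a^5) $ 1 = a"
    and "(vector [a, b, c, d, e] :: 'a^5) $ 2 = b"
    and "(vector [a, b, c, d, e] :: 'a^5) $ 3 = c"
    and "(vector [a, b, c, d, e] :: 'a^5) $ 4 = d"
    and "(vector [a, b, c, d, e] :: 'a^5) $ 5 = e"
  by (simp_all add: vector_def)

definition xk :: "real \<Rightarrow> real \<Rightarrow> nat \<Rightarrow> real \<Rightarrow> real" where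
  "xk a b k t = a + b * cos (t + 2 * (real k - 1) * theta)"

end

theory Submission
  imports Defs
begin

text \<open>The distance between \<open>z\<^sub>j\<close> and \<open>z\<^sub>k\<close> depends only on \<open>j - k\<close> modulo 10, and \<open>x\<^sub>k(t)\<close> is
  \<open>a + b cos \<phi>\<^sub>k\<close> with the phases \<open>\<phi>\<^sub>k = t + 2(k - 1)\<theta>\<close> in arithmetic progression.  The right-hand side is
  therefore a convolution on the cyclic group of order 10 with an even kernel, and such a convolution is
  diagonal on the harmonics \<open>cos (n \<phi>\<^sub>k)\<close>: it multiplies the \<open>n\<close>-th one by a Fourier coefficient \<open>D\<^sub>n(B)\<close> of
  the kernel (\<open>convolution_cos\<close>).

  The cube \<open>(a + b cos \<phi>)\<^sup>3\<close> contains the harmonics 0 to 3, whereas the left-hand side contains only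
  0 and 1.  Since the phases advance by a fifth of a turn, the harmonics 2 and 3 share one
  coefficient, \<open>D\<^sub>3 = D\<^sub>2\<close>, so a single equation \<open>D\<^sub>2(B) = 0\<close> removes both.  It is solved by the intermediate
  value theorem: \<open>D\<^sub>2\<close> is about \<open>-0.00008\<close> at \<open>B = 4.7\<close> and about \<open>0.00025\<close> at \<open>B = 4.71\<close> (\<open>root_multiplier_2\<close>).

  Comparing the harmonics 0 and 1 leaves two equations for \<open>a\<close> and \<open>b\<close>.  Eliminating the scale gives a linear
  equation for \<open>q = (b / a)\<^sup>2\<close>, and \<open>0 < q < 1\<close> amounts to \<open>D\<^sub>0 < 3 D\<^sub>1 < 2 D\<^sub>0\<close>; the remaining equation then determines \<open>a\<close>,
  provided that \<open>\<kappa> > 0\<close> (\<open>amplitudes\<close>).  For the latter both integrals defining \<open>\<kappa>\<close> must converge: their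
  integrands decay like \<open>|x|\<close> to the powers \<open>-7\<close> and \<open>-6\<close>, faster than the dimension 5 requires.\<close>

section \<open>Positivity of the constant \<open>\<kappa>\<close>\<close>

text \<open>On the dyadic shell \<open>2\<^sup>n \<le> 1 + |x| < 2\<^sup>n\<^sup>+\<^sup>1\<close> the function is at most \<open>2\<^sup>-\<^sup>n\<^sup>p\<close>, and the ball containing that
  shell has volume proportional to \<open>2\<^sup>n\<^sup>d\<close>, where \<open>d\<close> is the dimension.  Summing over the shells gives a
  geometric series of ratio \<open>2\<^sup>d\<^sup>-\<^sup>p < 1\<close>.\<close>

lemma integrable_powr_norm:
  fixes p :: real
  assumes p: "real DIM('a::euclidean_space) < p"
  shows "integrable lborel (\<lambda>x::'a. (1 + norm x) powr (- p))"
proof -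
  let ?f = "\<lambda>x::'a. (1 + norm x) powr (- p)"
  define d where "d = DIM('a)"
  define q where "q = 2 powr (real d - p)"
  have q: "0 < q" "q < 1"
    using p by (auto simp: q_def d_def powr_less_one)
  let ?g = "\<lambda>n::nat. \<lambda>x::'a. ennreal (2 powr (- p * n)) * indicator (ball 0 (2 ^ Suc n)) x"
  have bound: "ennreal (?f x) \<le> (\<Sum>n. ?g n x)" for x
  proof -
    define n where "n = nat \<lfloor>log 2 (1 + norm x)\<rfloor>"
    have "0 \<le> log 2 (1 + norm x)"
      by (subst zero_le_log_cancel_iff) (auto simp: add_pos_nonneg)
    then have n: "real n \<le> log 2 (1 + norm x)" "log 2 (1 + norm x) < real (Suc n)"
      unfolding n_def by linarith+
    have "2 powr real n \<le> 1 + norm x"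
      using n(1) by (simp add: le_log_iff add_pos_nonneg)
    have "1 + norm x < 2 powr real (Suc n)"
      using n(2) by (subst (asm) log_less_iff) (auto simp: add_pos_nonneg)
    then have "norm x < 2 ^ Suc n"
      by (subst (asm) powr_realpow) (auto intro: order.strict_trans1[rotated])
    have "?f x \<le> (2 powr real n) powr (- p)"
      using \<open>2 powr real n \<le> 1 + norm x\<close> p by (intro powr_mono2') auto
    also have "\<dots> = 2 powr (- p * n)"
      by (simp add: powr_powr mult.commute)
    finally have "ennreal (?f x) \<le> ?g n x"
      using \<open>norm x < 2 ^ Suc n\<close> by (simp add: ennreal_leI)
    also have "\<dots> \<le> (\<Sum>n. ?g n x)"
    proof -
      have "F n \<le> suminf F" for F :: "nat \<Rightarrow> ennreal"
        using sum_le_suminf[of F "{n}"] by simp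
      then show ?thesis .
    qed
    finally show ?thesis .
  qed
  have term_eq: "(\<integral>\<^sup>+x. ?g n x \<partial>lborel) = ennreal (unit_ball_vol d * 2 ^ d * q ^ n)" for n
  proof -
    have "(\<integral>\<^sup>+x. ?g n x \<partial>lborel)
        = ennreal (2 powr (- p * n)) * ennreal (unit_ball_vol d * (2 ^ Suc n) ^ d)"
      by (subst nn_integral_cmult_indicator) (auto simp: emeasure_ball d_def)
    also have "\<dots> = ennreal (2 powr (- p * n) * (unit_ball_vol d * (2 ^ Suc n) ^ d))"
      by (subst ennreal_mult) auto
    also have "(2 ^ Suc n) ^ d = (2 ^ d * 2 powr (real d * n) :: real)"
      by (simp add: power_mult_distrib powr_realpow flip: power_mult of_nat_mult)
    also have "2 powr (- p * n) * (unit_ball_vol d * (2 ^ d * 2 powr (real d * n)))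
        = unit_ball_vol d * 2 ^ d * q ^ n"
      by (simp add: q_def powr_power algebra_simps flip: powr_add)
    finally show ?thesis .
  qed
  have "(\<integral>\<^sup>+x. ennreal (?f x) \<partial>lborel) \<le> (\<integral>\<^sup>+x. (\<Sum>n. ?g n x) \<partial>lborel)"
    by (intro nn_integral_mono bound)
  also have "\<dots> = (\<Sum>n. \<integral>\<^sup>+x. ?g n x \<partial>lborel)"
    by (intro nn_integral_suminf borel_measurable_times_ennreal borel_measurable_const
        borel_measurable_indicator) simp
  also have "\<dots> < \<infinity>"
  proof -
    have "summable (\<lambda>n. unit_ball_vol d * 2 ^ d * q ^ n)"
      using q by (intro summable_mult summable_geometric) auto
    then have "(\<Sum>n. ennreal (unit_ball_vol d * 2 ^ d * q ^ n)) \<noteq> top"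
      using q by (intro ennreal_suminf_neq_top) (auto intro!: mult_nonneg_nonneg)
    then show ?thesis
      unfolding term_eq by (simp add: top.not_eq_extremum)
  qed
  finally show ?thesis
    by (intro integrableI_nonneg) auto
qed

lemma integrable_power_quadratic:
  fixes c p :: real
  assumes c: "1 \<le> c" and p: "real DIM('a::euclidean_space) < 2 * p"
  shows "integrable lborel (\<lambda>x::'a. (1 + (norm x)\<^sup>2 / c) powr (- p))"
proof (rule Bochner_Integration.integrable_bound)
  show "integrable lborel (\<lambda>x::'a. (2 * c) powr p * (1 + norm x) powr (- (2 * p)))"
    using integrable_powr_norm[OF p] by (rule integrable_mult_right)
  show "AE x::'a in lborel. norm ((1 + (norm x)\<^sup>2 / c) powr (- p))
      \<le> norm ((2 * c) powr p * (1 + norm x) powr (- (2 * p)))"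
  proof (intro AE_I2)
    fix x :: 'a
    have "(1 + norm x)\<^sup>2 \<le> 2 * (1 + (norm x)\<^sup>2)"
      using zero_le_power2[of "1 - norm x"] by (simp add: power2_eq_square algebra_simps)
    also have "\<dots> \<le> 2 * (c + (norm x)\<^sup>2)"
      using c by simp
    also have "\<dots> = 2 * c * (1 + (norm x)\<^sup>2 / c)"
      using c by (simp add: field_simps)
    finally have "(1 + norm x)\<^sup>2 / (2 * c) \<le> 1 + (norm x)\<^sup>2 / c"
      using c by (subst pos_divide_le_eq) (auto simp: mult.commute)
    moreover have "0 < (1 + norm x)\<^sup>2 / (2 * c)"
      using c norm_ge_zero[of x] by (intro divide_pos_pos zero_less_power) linarith+
    moreover have "0 \<le> p"
      using p by (smt (verit) of_nat_0_le_iff)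
    ultimately have "(1 + (norm x)\<^sup>2 / c) powr (- p) \<le> ((1 + norm x)\<^sup>2 / (2 * c)) powr (- p)"
      by (intro powr_mono2') auto
    also have "\<dots> = (2 * c) powr p * (1 + norm x) powr (- (2 * p))"
    proof -
      have "(1 + norm x)\<^sup>2 = (1 + norm x) powr 2"
        by (simp add: powr_numeral add_pos_nonneg)
      then have "(1 + norm x)\<^sup>2 powr p = (1 + norm x) powr (2 * p)"
        by (simp only: powr_powr)
      then show ?thesis
        using c by (simp add: powr_divide powr_powr powr_minus_divide)
    qed
    finally show "norm ((1 + (norm x)\<^sup>2 / c) powr (- p))
        \<le> norm ((2 * c) powr p * (1 + norm x) powr (- (2 * p)))"
      by simp
  qed
  show "(\<lambda>x::'a. (1 + (norm x)\<^sup>2 / c) powr (- p)) \<in> borel_measurable lborel"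
    by measurable
qed

lemma integral_pos_if_pos_on_ball:
  fixes f :: "'a::euclidean_space \<Rightarrow> real"
  assumes f: "integrable lborel f" and nonneg: "\<And>x. 0 \<le> f x"
    and pos: "\<And>x. x \<in> ball c r \<Longrightarrow> 0 < f x" and r: "0 < r"
  shows "0 < (LINT x|lborel. f x)"
proof -
  have "(LINT x|lborel. f x) \<noteq> 0"
  proof
    assume "(LINT x|lborel. f x) = 0"
    then have "AE x in lborel. f x = 0"
      using integral_nonneg_eq_0_iff_AE[OF f] nonneg by simp
    then have "AE x in lborel. x \<notin> ball c r"
      by eventually_elim (use pos in force)
    then have "ball c r \<in> null_sets lborel"
      by (subst (asm) AE_iff_null_sets[symmetric]) auto
    then have "unit_ball_vol (real DIM('a)) * r ^ DIM('a) \<le> 0"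
      using r by (simp add: null_sets_def emeasure_ball ennreal_eq_0_iff)
    moreover have "0 < unit_ball_vol (real DIM('a)) * r ^ DIM('a)"
      using r by (intro mult_pos_pos) auto
    ultimately show False
      by simp
  qed
  moreover have "0 \<le> (LINT x|lborel. f x)"
    using nonneg by (intro Bochner_Integration.integral_nonneg) auto
  ultimately show ?thesis
    by simp
qed

text \<open>With \<open>s = |x|\<^sup>2 / 15\<close>, the Euler field satisfies \<open>x \<cdot> \<nabla>s = 2s\<close>; hence \<open>\<Lambda>W\<close> is
  \<open>3/2 (1 + s) - 3s = 3/2 (1 - s)\<close> times \<open>(1 + s)\<close> to the power \<open>-5/2\<close>.\<close>

lemma Lambda_W:
  "Lambda W x = 3/2 * (1 - (norm x)\<^sup>2 / 15) * (1 + (norm x)\<^sup>2 / 15) powr (- (5/2))"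
proof -
  define s where "s = (norm x)\<^sup>2 / 15"
  have s: "0 < 1 + s"
    by (simp add: s_def add_pos_nonneg)
  have W_eq: "W = (\<lambda>y. (1 + (y \<bullet> y) / 15) powr (- (3/2)))"
    by (auto simp: W_def power2_norm_eq_inner)
  have "(W has_derivative (\<lambda>h. - (3/2) * (1 + s) powr (- (5/2)) * (2 * (x \<bullet> h) / 15))) (at x)"
  proof -
    have "((\<lambda>y. 1 + (y \<bullet> y) / 15) has_derivative (\<lambda>h. 2 * (x \<bullet> h) / 15)) (at x)"
      by (auto intro!: derivative_eq_intros simp: inner_commute)
    moreover have "((\<lambda>v. v powr (- (3/2))) has_real_derivative
        - (3/2) * (1 + s) powr (- (3/2) - 1)) (at (1 + (x \<bullet> x) / 15))"
      using s by (auto intro!: derivative_eq_intros simp: s_def power2_norm_eq_inner)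
    ultimately have "((\<lambda>y. (1 + (y \<bullet> y) / 15) powr (- (3/2))) has_derivative
        (\<lambda>h. - (3/2) * (1 + s) powr (- (3/2) - 1) * (2 * (x \<bullet> h) / 15))) (at x)"
      unfolding has_field_derivative_def by (rule has_derivative_compose)
    then show ?thesis
      unfolding W_eq by (simp add: mult_ac)
  qed
  then have "frechet_derivative W (at x) x = - (3/2) * (1 + s) powr (- (5/2)) * (2 * s)"
    using fun_cong[OF frechet_derivative_at] by (fastforce simp: s_def power2_norm_eq_inner)
  moreover have "W x = (1 + s) * (1 + s) powr (- (5/2))"
  proof -
    have "(1 + s) powr (- (3/2)) = (1 + s) powr (1 + - (5/2))"
      by simp
    also have "\<dots> = (1 + s) * (1 + s) powr (- (5/2))"
      using s unfolding powr_add by simp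
    finally show ?thesis
      by (simp add: W_def s_def)
  qed
  ultimately show ?thesis
    by (simp add: Lambda_def s_def algebra_simps)
qed

text \<open>A Bochner integral of a non-integrable function is 0 by convention, so the positivity of \<open>\<kappa>\<close> rests on
  the convergence of both integrals and not just on the signs of the integrands.  The function \<open>\<Lambda>W\<close>
  changes sign, at \<open>|x|\<^sup>2 = 15\<close>, but it does not vanish on the unit ball.\<close>

lemma kappa_pos: "0 < kappa"
proof -
  let ?u = "\<lambda>x::real^5. 1 + (norm x)\<^sup>2 / 15"
  have u: "0 < ?u x" for x
    by (simp add: add_pos_nonneg)
  have "0 < (LINT x|lborel. W x powr (7/3))"
  proof (rule integral_pos_if_pos_on_ball[where c = 0 and r = 1])
    show "integrable lborel (\<lambda>x. W x powr (7/3))"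
      using integrable_power_quadratic[of 15 "7/2", where 'a = "real^5"]
      by (simp add: W_def powr_powr)
    show "0 < W x powr (7/3)" for x
      using u[of x] by (simp add: W_def)
  qed auto
  moreover have "0 < (LINT x|lborel. (Lambda W x)\<^sup>2)"
  proof (rule integral_pos_if_pos_on_ball[where c = 0 and r = 1])
    show "integrable lborel (\<lambda>x. (Lambda W x)\<^sup>2)"
    proof (rule Bochner_Integration.integrable_bound)
      show "integrable lborel (\<lambda>x. (9/4) * ?u x powr (-3))"
        using integrable_power_quadratic[of 15 3, where 'a = "real^5"]
        by (intro integrable_mult_right) simp
      show "(\<lambda>x. (Lambda W x)\<^sup>2) \<in> borel_measurable lborel"
        unfolding Lambda_W by measurable
      show "AE x in lborel. norm ((Lambda W x)\<^sup>2) \<le> norm ((9/4) * ?u x powr (-3))"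
      proof (intro AE_I2)
        fix x :: "real^5"
        have "(Lambda W x)\<^sup>2 = 9/4 * (1 - (norm x)\<^sup>2 / 15)\<^sup>2 * (?u x powr (- (5/2)))\<^sup>2"
          unfolding Lambda_W power_mult_distrib by (simp add: power_divide)
        also have "\<dots> \<le> 9/4 * (?u x)\<^sup>2 * (?u x powr (- (5/2)))\<^sup>2"
        proof -
          have "\<bar>1 - v\<bar> \<le> \<bar>1 + v\<bar>" if "0 \<le> v" for v :: real
            using that by linarith
          then show ?thesis
            by (intro mult_right_mono mult_left_mono iffD1[OF abs_le_square_iff]) auto
        qed
        also have "\<dots> = 9/4 * (?u x powr 2 * ?u x powr (-5))"
          using u[of x] by (simp add: powr_power)
        also have "\<dots> = 9/4 * ?u x powr (-3)"
          by (simp only: powr_add[symmetric]) simp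
        finally show "norm ((Lambda W x)\<^sup>2) \<le> norm ((9/4) * ?u x powr (-3))"
          by simp
      qed
    qed
    show "0 < (Lambda W x)\<^sup>2" if "x \<in> ball 0 1" for x
    proof -
      have "(norm x)\<^sup>2 \<le> 1"
        using that by (simp add: power_le_one)
      then show ?thesis
        using u[of x] by (simp add: Lambda_W)
    qed
  qed auto
  ultimately show ?thesis
    by (simp add: kappa_def L2_norm_def)
qed

section \<open>Trigonometry of the angle \<open>\<theta> = \<pi> / 5\<close>\<close>

text \<open>From \<open>3\<theta> = \<pi> - 2\<theta>\<close> the number \<open>c = cos \<theta>\<close> is a root of \<open>4c\<^sup>3 + 2c\<^sup>2 - 3c - 1 = (c + 1)(4c\<^sup>2 - 2c - 1)\<close>.\<close>

lemma cos_theta: "cos theta = (1 + sqrt 5) / 4"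
proof -
  let ?c = "cos theta"
  have "0 < theta" "theta < pi / 2"
    by (auto simp: theta_def)
  then have pos: "0 < ?c"
    by (intro cos_gt_zero) auto
  have "cos (3 * theta) = cos (pi - 2 * theta)"
    by (simp add: theta_def)
  then have "4 * ?c ^ 3 - 3 * ?c = - (2 * ?c\<^sup>2 - 1)"
    by (simp add: cos_treble_cos cos_double_cos)
  then have "(?c + 1) * ((4 * ?c - 1)\<^sup>2 - 5) = 0"
    by (simp add: power2_eq_square power3_eq_cube algebra_simps)
  then have "(4 * ?c - 1)\<^sup>2 = 5"
    using pos by auto
  then have "4 * ?c - 1 = sqrt 5 \<or> 4 * ?c - 1 = - sqrt 5"
    by (metis power2_eq_iff real_sqrt_pow2 zero_le_numeral)
  moreover have "1 < sqrt 5"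
    by simp
  ultimately show ?thesis
    using pos by auto
qed

lemma cos_add_periods: "cos (x + 10 * real_of_int n * theta) = cos x"
  and sin_add_periods: "sin (x + 10 * real_of_int n * theta) = sin x"
proof -
  have eq: "10 * real_of_int n * theta = 2 * pi * real_of_int n"
    by (simp add: theta_def)
  show "cos (x + 10 * real_of_int n * theta) = cos x" "sin (x + 10 * real_of_int n * theta) = sin x"
    unfolding eq by (simp_all add: cos_add sin_add)
qed

lemma cos_even_multiples_theta:
  "cos (2 * theta) = cos theta - 1 / 2"
  "cos (4 * theta) = - cos theta"
  "cos (6 * theta) = - cos theta"
  "cos (8 * theta) = cos theta - 1 / 2"
  "cos (10 * theta) = 1"
proof -
  show 2: "cos (2 * theta) = cos theta - 1 / 2"
    unfolding cos_double_cos cos_theta by (simp add: power2_eq_square field_simps)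
  show 4: "cos (4 * theta) = - cos theta"
    using cos_pi_minus[of theta] by (simp add: theta_def)
  show "cos (6 * theta) = - cos theta"
    using cos_add_periods[of "- (4 * theta)" 1] 4 by simp
  show "cos (8 * theta) = cos theta - 1 / 2"
    using cos_add_periods[of "- (2 * theta)" 1] 2 by simp
  show "cos (10 * theta) = 1"
    using cos_add_periods[of 0 1] by simp
qed

lemma cos_3_theta: "cos (3 * theta) = 1 / 2 - cos theta"
  using cos_pi_minus[of "2 * theta"] cos_even_multiples_theta(1) by (simp add: theta_def)

lemma cos_theta_bounds: "0.80901 < cos theta" "cos theta < 0.80902"
proof -
  have "2.23606 < sqrt 5"
    by (rule real_less_rsqrt) (simp add: power2_eq_square)
  moreover have "sqrt 5 < 2.23607"
    by (rule real_less_lsqrt) (simp_all add: power2_eq_square)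
  ultimately show "0.80901 < cos theta" "cos theta < 0.80902"
    by (auto simp: cos_theta)
qed

section \<open>Distances in the configuration\<close>

text \<open>For \<open>B \<ge> 0\<close>, the distance between two points of the configuration whose indices differ by \<open>m\<close>.  The
  first two coordinates run through the circle of radius 1 with angular step \<open>\<theta>\<close>, the next two through the
  circle of radius \<open>\<surd>B\<close> with step \<open>2\<theta>\<close>; to the squared distance each contributes twice its squared radius
  times one minus the cosine of the angle travelled.  Integer indices make the period 10 and the evenness expressible.\<close>

definition chord :: "real \<Rightarrow> int \<Rightarrow> real" where
  "chord B m = sqrt (2 * (1 - cos (m * theta)) + 2 * B * (1 - cos (2 * m * theta)))"

lemma norm_z_diff:
  assumes "0 \<le> B"
  shows "norm (z B j - z B k) = chord B (int j - int k)"
proof -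
  have UNIV_5: "(UNIV :: 5 set) = {1, 2, 3, 4, 5}"
  proof -
    have "x \<in> {1, 2, 3, 4, 5}" for x :: 5
    proof (induct x)
      case (of_int z)
      then have "z = 0 \<or> z = 1 \<or> z = 2 \<or> z = 3 \<or> z = 4"
        by fastforce
      then show ?case
        by auto
    qed
    then show ?thesis
      by blast
  qed
  have norm2: "(norm v)\<^sup>2 = (v $ 1)\<^sup>2 + (v $ 2)\<^sup>2 + (v $ 3)\<^sup>2 + (v $ 4)\<^sup>2 + (v $ 5)\<^sup>2"
    for v :: "real^5"
    unfolding power2_norm_eq_inner inner_vec_def UNIV_5 by (simp add: power2_eq_square)
  have chord2: "(cos x - cos y)\<^sup>2 + (sin x - sin y)\<^sup>2 = 2 * (1 - cos (x - y))" for x y :: real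
  proof -
    have "(cos x - cos y)\<^sup>2 + (sin x - sin y)\<^sup>2
        = ((sin x)\<^sup>2 + (cos x)\<^sup>2) + ((sin y)\<^sup>2 + (cos y)\<^sup>2) - 2 * (cos x * cos y + sin x * sin y)"
      by (simp add: power2_eq_square algebra_simps)
    then show ?thesis
      by (simp add: cos_diff)
  qed
  have z_eq: "z B i = vector [cos ((real i - 1) * theta), sin ((real i - 1) * theta),
      sqrt B * cos (2 * ((real i - 1) * theta)), sqrt B * sin (2 * ((real i - 1) * theta)), 0]" for i
    by (simp only: z_def mult.assoc)
  let ?x = "(real j - 1) * theta" and ?y = "(real k - 1) * theta"
  have "(norm (z B j - z B k))\<^sup>2 = ((cos ?x - cos ?y)\<^sup>2 + (sin ?x - sin ?y)\<^sup>2)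
      + (sqrt B)\<^sup>2 * ((cos (2 * ?x) - cos (2 * ?y))\<^sup>2 + (sin (2 * ?x) - sin (2 * ?y))\<^sup>2)"
    unfolding norm2 z_eq
    by (simp add: vector_5 power_mult_distrib distrib_left flip: right_diff_distrib)
  also have "\<dots> = 2 * (1 - cos ((real j - real k) * theta))
      + B * (2 * (1 - cos (2 * (real j - real k) * theta)))"
    using assms unfolding chord2 by (simp add: algebra_simps)
  finally show ?thesis
    unfolding chord_def by (intro real_sqrt_unique[symmetric]) (simp_all add: algebra_simps)
qed

lemma chord_0: "chord B 0 = 0"
  by (simp add: chord_def)

lemma chord_periodic: "chord B (m + 10) = chord B m"
proof -
  have "cos (real_of_int (m + 10) * theta) = cos (m * theta)"
    using cos_add_periods[of "m * theta" 1] by (simp add: algebra_simps)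
  moreover have "cos (2 * real_of_int (m + 10) * theta) = cos (2 * m * theta)"
    using cos_add_periods[of "2 * m * theta" 2] by (simp add: algebra_simps)
  ultimately show ?thesis
    by (simp add: chord_def)
qed

lemma chord_minus: "chord B (- m) = chord B m"
  by (simp add: chord_def)

lemma chord_reflect: "chord B (10 - m) = chord B m"
  using chord_periodic[of B "- m"] chord_minus[of B m] by (simp add: algebra_simps)

section \<open>Convolution with the inverse cubes of the distances\<close>

text \<open>The \<open>n\<close>-th Fourier coefficient \<open>D\<^sub>n(B)\<close> of the kernel \<open>m \<mapsto> |z\<^sub>k\<^sub>+\<^sub>m - z\<^sub>k|\<close> to the power \<open>-3\<close>, with respect to
  phases advancing by \<open>2\<theta>\<close> per step.\<close>

definition multiplier :: "real \<Rightarrow> nat \<Rightarrow> real" where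
  "multiplier B n = (\<Sum>m\<in>{1..9::nat}. chord B m powi (-3) * cos (2 * real n * real m * theta))"

text \<open>The addition theorem splits the sum into a multiple of \<open>cos (n\<phi>)\<close> and a multiple of \<open>sin (n\<phi>)\<close>.  The
  coefficient of the latter pairs the even kernel with an odd function and vanishes under \<open>m \<mapsto> 10 - m\<close>.\<close>

lemma convolution_cos:
  "(\<Sum>m\<in>{1..9::nat}. chord B m powi (-3) * cos (real n * (\<phi> + 2 * real m * theta)))
     = multiplier B n * cos (real n * \<phi>)"
proof -
  define f where "f m = chord B (int m) powi (-3) * sin (2 * real n * real m * theta)" for m :: nat
  have odd: "f (10 - m) = - f m" if "m \<in> {1..9}" for m
  proof -
    have "chord B (int (10 - m)) = chord B m"
      using that chord_reflect[of B m] by (simp add: of_nat_diff)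
    moreover have "sin (2 * real n * real (10 - m) * theta) = - sin (2 * real n * real m * theta)"
      using that sin_add_periods[of "- (2 * real n * real m * theta)" "2 * int n"]
      by (simp add: of_nat_diff algebra_simps)
    ultimately show ?thesis
      by (simp add: f_def)
  qed
  have "(\<Sum>m\<in>{1..9}. f m) = (\<Sum>m\<in>{1..9}. f (10 - m))"
    using sum.atLeastAtMost_rev[of f 1 9] by simp
  also have "\<dots> = - (\<Sum>m\<in>{1..9}. f m)"
    unfolding sum_negf[symmetric] using odd by (intro sum.cong) auto
  finally have sin0: "(\<Sum>m\<in>{1..9}. f m) = 0"
    by simp
  have "(\<Sum>m\<in>{1..9::nat}. chord B m powi (-3) * cos (real n * (\<phi> + 2 * real m * theta)))
      = (\<Sum>m\<in>{1..9::nat}. chord B m powi (-3) * cos (2 * real n * real m * theta) * cos (real n * \<phi>)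
          - f m * sin (real n * \<phi>))"
  proof (intro sum.cong refl)
    fix m :: nat
    have "real n * (\<phi> + 2 * real m * theta) = real n * \<phi> + 2 * real n * real m * theta"
      by (simp add: algebra_simps)
    then show "chord B m powi (-3) * cos (real n * (\<phi> + 2 * real m * theta))
        = chord B m powi (-3) * cos (2 * real n * real m * theta) * cos (real n * \<phi>) - f m * sin (real n * \<phi>)"
      by (simp only: cos_add f_def) (simp add: algebra_simps)
  qed
  then show ?thesis
    using sin0 by (simp add: multiplier_def sum_subtractf flip: sum_distrib_right)
qed

lemma cubed_cosine:
  fixes a b x :: real
  shows "(a + b * cos x) ^ 3 = (a ^ 3 + 3/2 * a * b\<^sup>2) + (3 * a\<^sup>2 * b + 3/4 * b ^ 3) * cos x
     + 3/2 * a * b\<^sup>2 * cos (2 * x) + 1/4 * b ^ 3 * cos (3 * x)"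
  unfolding cos_double_cos cos_treble_cos by (simp add: power2_eq_square power3_eq_cube field_simps)

lemma convolution_cube:
  "(\<Sum>m\<in>{1..9::nat}. chord B m powi (-3) * (a + b * cos (\<phi> + 2 * real m * theta)) ^ 3)
     = (a ^ 3 + 3/2 * a * b\<^sup>2) * multiplier B 0
       + (3 * a\<^sup>2 * b + 3/4 * b ^ 3) * multiplier B 1 * cos \<phi>
       + 3/2 * a * b\<^sup>2 * multiplier B 2 * cos (2 * \<phi>)
       + 1/4 * b ^ 3 * multiplier B 3 * cos (3 * \<phi>)" (is "?lhs = ?rhs")
proof -
  let ?w = "\<lambda>m::nat. chord B m powi (-3)" and ?x = "\<lambda>m::nat. \<phi> + 2 * real m * theta"
  have "?lhs = (\<Sum>m\<in>{1..9::nat}. (a ^ 3 + 3/2 * a * b\<^sup>2) * (?w m * cos (real 0 * ?x m))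
      + (3 * a\<^sup>2 * b + 3/4 * b ^ 3) * (?w m * cos (real 1 * ?x m))
      + 3/2 * a * b\<^sup>2 * (?w m * cos (real 2 * ?x m))
      + 1/4 * b ^ 3 * (?w m * cos (real 3 * ?x m)))"
    unfolding cubed_cosine by (intro sum.cong refl) (simp add: algebra_simps)
  also have "\<dots> = ?rhs"
    unfolding sum.distrib sum_distrib_left[symmetric] convolution_cos
    by (simp only: of_nat_0 of_nat_1 of_nat_numeral mult_zero_left mult_1 cos_zero mult_1_right mult.assoc)
  finally show ?thesis .
qed

lemma sum_over_period:
  fixes h :: "int \<Rightarrow> 'a::ab_group_add"
  assumes "\<And>m. h (m + int n) = h m"
  shows "(\<Sum>j\<in>{1..n}. h (int j - int k)) = (\<Sum>j\<in>{1..n}. h (int j))"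
proof (induction k)
  case (Suc k)
  let ?g = "\<lambda>j. h (int j - int k)"
  have "(\<Sum>j\<in>{1..n}. h (int j - int (Suc k))) = (\<Sum>j<n. ?g j)"
    unfolding One_nat_def sum.atLeast1_atMost_eq by (simp add: algebra_simps)
  also have "\<dots> = (\<Sum>j<n. ?g (Suc j))"
  proof -
    have "?g 0 + (\<Sum>j<n. ?g (Suc j)) = (\<Sum>j<n. ?g j) + ?g n"
      using sum.lessThan_Suc_shift[of ?g n] by simp
    moreover have "?g n = ?g 0"
      using assms[of "- int k"] by (simp add: algebra_simps)
    ultimately show ?thesis
      by (simp add: algebra_simps)
  qed
  also have "\<dots> = (\<Sum>j\<in>{1..n}. ?g j)"
    unfolding One_nat_def sum.atLeast1_atMost_eq ..
  finally show ?case
    using Suc.IH by simp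
qed simp

text \<open>Reindexing by \<open>m = j - k\<close> turns the interaction sum into a convolution.  The index \<open>j = k\<close> may be
  included at no cost: the distance is then 0, and 0 to the power \<open>-3\<close> is 0.\<close>

lemma interaction_sum:
  assumes B: "0 \<le> B" and k: "k \<in> {1..10}"
  shows "(\<Sum>j\<in>{1..10} - {k}. norm (z B j - z B k) powi (-3) * (xk a b j t) ^ 3)
     = (\<Sum>m\<in>{1..9::nat}. chord B m powi (-3)
          * (a + b * cos (t + 2 * (real k - 1) * theta + 2 * real m * theta)) ^ 3)"
proof -
  define h where "h m = chord B m powi (-3)
      * (a + b * cos (t + 2 * (real k - 1) * theta + 2 * m * theta)) ^ 3" for m :: int
  have "h (m + int 10) = h m" for m
  proof -
    have "cos (t + 2 * (real k - 1) * theta + 2 * real_of_int (m + 10) * theta)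
        = cos (t + 2 * (real k - 1) * theta + 2 * m * theta)"
      using cos_add_periods[of "t + 2 * (real k - 1) * theta + 2 * m * theta" 2]
      by (simp add: algebra_simps)
    then show ?thesis
      by (simp add: h_def chord_periodic)
  qed
  note period = this
  have h0: "h 0 = 0"
    by (simp add: h_def chord_0)
  have "(\<Sum>j\<in>{1..10} - {k}. norm (z B j - z B k) powi (-3) * (xk a b j t) ^ 3)
      = (\<Sum>j\<in>{1..10} - {k}. h (int j - int k))"
    unfolding norm_z_diff[OF B] h_def xk_def by (simp add: algebra_simps)
  also have "\<dots> = (\<Sum>j\<in>{1..10}. h (int j - int k))"
    using h0 by (intro sum.mono_neutral_left) auto
  also have "\<dots> = (\<Sum>j\<in>{1..10}. h (int j))"
    by (rule sum_over_period) (rule period)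
  also have "\<dots> = (\<Sum>j\<in>{1..9}. h (int j))"
    using h0 period[of 0] by (simp add: eval_nat_numeral)
  finally show ?thesis
    by (simp add: h_def)
qed

section \<open>The Fourier coefficients for \<open>B\<close> between 4.7 and 4.71\<close>

lemma multiplier_half:
  "multiplier B n = 1/8
     + 2 * (\<Sum>m\<in>{1..4::nat}. chord B m powi (-3) * cos (2 * real n * real m * theta))"
proof -
  define f where "f m = chord B (int m) powi (-3) * cos (2 * real n * real m * theta)" for m :: nat
  have even: "f (10 - m) = f m" if "m \<le> 10" for m
    using that chord_reflect[of B m]
      cos_add_periods[of "- (2 * real n * real m * theta)" "2 * int n"]
    by (simp add: f_def of_nat_diff algebra_simps)
  have "chord B 5 = 2"
  proof -
    have "cos (5 * theta) = - 1"
      by (simp add: theta_def)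
    then show ?thesis
      by (simp add: chord_def cos_even_multiples_theta)
  qed
  moreover have "cos (2 * real n * real 5 * theta) = 1"
    using cos_add_periods[of 0 "int n"] by (simp add: mult_ac)
  ultimately have "f 5 = 1/8"
    by (simp add: f_def power_int_minus)
  moreover have "multiplier B n = f 1 + f 2 + f 3 + f 4 + f 5 + f 6 + f 7 + f 8 + f 9"
    unfolding multiplier_def f_def by (simp add: eval_nat_numeral)
  moreover have "f 6 = f 4" "f 7 = f 3" "f 8 = f 2" "f 9 = f 1"
    using even[of 4] even[of 3] even[of 2] even[of 1] by simp_all
  moreover have "(\<Sum>m\<in>{1..4}. f m) = f 1 + f 2 + f 3 + f 4"
    by (simp add: eval_nat_numeral)
  ultimately show ?thesis
    unfolding f_def by simp
qed

text \<open>Everything is expressed through \<open>cos \<theta>\<close> and the two pair sums over the distances \<open>m = 1, 4\<close> and \<open>m = 2, 3\<close>: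
  the cosines in the coefficients agree within each pair, since the phase \<open>2m\<theta>\<close> depends on \<open>m\<close> modulo 5 and
  the cosine is even.  The summand \<open>1/8\<close> is the term \<open>m = 5\<close>: half a turn on the first circle
  and a full turn on the second, hence distance 2 for every \<open>B\<close>.  The
  same dependence modulo 5 gives \<open>D\<^sub>3 = D\<^sub>2\<close>, as \<open>3 + 2 = 5\<close>.\<close>

lemma multiplier_values:
  "multiplier B 0 = 1/8 + 2 * (chord B 1 powi (-3) + chord B 4 powi (-3))
     + 2 * (chord B 2 powi (-3) + chord B 3 powi (-3))"
  "multiplier B 1 = 1/8 + (2 * cos theta - 1) * (chord B 1 powi (-3) + chord B 4 powi (-3))
     - 2 * cos theta * (chord B 2 powi (-3) + chord B 3 powi (-3))"
  "multiplier B 2 = 1/8 - 2 * cos theta * (chord B 1 powi (-3) + chord B 4 powi (-3))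
     + (2 * cos theta - 1) * (chord B 2 powi (-3) + chord B 3 powi (-3))"
  "multiplier B 3 = multiplier B 2"
proof -
  have sum4: "(\<Sum>m\<in>{1..4::nat}. f m) = f 1 + f 2 + f 3 + f 4" for f :: "nat \<Rightarrow> real"
    by (simp add: eval_nat_numeral)
  have 12: "cos (12 * theta) = cos theta - 1 / 2"
    using cos_add_periods[of "2 * theta" 1] cos_even_multiples_theta(1) by simp
  have 16: "cos (16 * theta) = - cos theta"
    using cos_add_periods[of "6 * theta" 1] cos_even_multiples_theta(3) by simp
  show "multiplier B 0 = 1/8 + 2 * (chord B 1 powi (-3) + chord B 4 powi (-3))
     + 2 * (chord B 2 powi (-3) + chord B 3 powi (-3))"
    unfolding multiplier_half sum4 by simp
  show "multiplier B 1 = 1/8 + (2 * cos theta - 1) * (chord B 1 powi (-3) + chord B 4 powi (-3))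
     - 2 * cos theta * (chord B 2 powi (-3) + chord B 3 powi (-3))"
    unfolding multiplier_half sum4
    by (simp add: cos_even_multiples_theta) (simp add: algebra_simps)
  show "multiplier B 2 = 1/8 - 2 * cos theta * (chord B 1 powi (-3) + chord B 4 powi (-3))
     + (2 * cos theta - 1) * (chord B 2 powi (-3) + chord B 3 powi (-3))"
    unfolding multiplier_half sum4
    by (simp add: cos_even_multiples_theta 12 16) (simp add: algebra_simps)
  have "cos (2 * real 3 * real m * theta) = cos (2 * real 2 * real m * theta)" for m
    using cos_add_periods[of "- (4 * real m * theta)" "int m"] by (simp add: algebra_simps)
  then show "multiplier B 3 = multiplier B 2"
    unfolding multiplier_def by simp
qed

lemma chord_power2:
  "(chord B 1)\<^sup>2 = 2 * (1 - cos theta) + B * (3 - 2 * cos theta)"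
  "(chord B 2)\<^sup>2 = 3 - 2 * cos theta + 2 * B * (1 + cos theta)"
  "(chord B 3)\<^sup>2 = 1 + 2 * cos theta + 2 * B * (1 + cos theta)"
  "(chord B 4)\<^sup>2 = 2 * (1 + cos theta) + B * (3 - 2 * cos theta)"
  if "0 \<le> B"
proof -
  have "(chord B m)\<^sup>2 = 2 * (1 - cos (m * theta)) + 2 * B * (1 - cos (2 * m * theta))" for m
    unfolding chord_def using that by (intro real_sqrt_pow2 add_nonneg_nonneg mult_nonneg_nonneg) auto
  from this[of 1] this[of 2] this[of 3] this[of 4]
  show "(chord B 1)\<^sup>2 = 2 * (1 - cos theta) + B * (3 - 2 * cos theta)"
    "(chord B 2)\<^sup>2 = 3 - 2 * cos theta + 2 * B * (1 + cos theta)"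
    "(chord B 3)\<^sup>2 = 1 + 2 * cos theta + 2 * B * (1 + cos theta)"
    "(chord B 4)\<^sup>2 = 2 * (1 + cos theta) + B * (3 - 2 * cos theta)"
    by (simp_all add: cos_even_multiples_theta cos_3_theta)
qed

lemma chord_pos:
  assumes "0 \<le> B" "\<not> 10 dvd m"
  shows "0 < chord B m"
proof -
  have "cos (m * theta) \<noteq> 1"
  proof
    assume "cos (m * theta) = 1"
    then obtain n :: int where "m * theta = n * (2 * pi)"
      by (auto simp: cos_one_2pi_int mult_ac)
    then have "pi * real_of_int m = pi * real_of_int (10 * n)"
      by (simp add: theta_def)
    then have "real_of_int m = real_of_int (10 * n)"
      by (simp only: mult_cancel_left) simp
    then show False
      using assms(2) by (simp only: of_int_eq_iff) simp
  qed
  then have "0 < 2 * (1 - cos (m * theta))"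
    using cos_le_one[of "m * theta"] by (simp add: order.strict_iff_order)
  moreover have "0 \<le> 2 * B * (1 - cos (2 * m * theta))"
    using assms(1) by (intro mult_nonneg_nonneg) auto
  ultimately show ?thesis
    unfolding chord_def by simp
qed

text \<open>These transfer rational bounds from \<open>r\<^sup>2\<close>, which for a chord is linear in \<open>cos \<theta>\<close>, to the kernel.\<close>

lemma inverse_cube_bounds:
  fixes r :: real
  assumes "0 < r"
  shows "r\<^sup>2 \<le> u\<^sup>2 \<Longrightarrow> 0 \<le> u \<Longrightarrow> 1 / u ^ 3 \<le> r powi (-3)"
    and "l\<^sup>2 \<le> r\<^sup>2 \<Longrightarrow> 0 < l \<Longrightarrow> r powi (-3) \<le> 1 / l ^ 3"
proof -
  show "1 / u ^ 3 \<le> r powi (-3)" if "r\<^sup>2 \<le> u\<^sup>2" "0 \<le> u"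
  proof -
    have "r \<le> u"
      using that by (rule power2_le_imp_le)
    then show ?thesis
      using assms by (simp add: power_int_minus divide_inverse le_imp_inverse_le power_mono)
  qed
  show "r powi (-3) \<le> 1 / l ^ 3" if "l\<^sup>2 \<le> r\<^sup>2" "0 < l"
  proof -
    have "l \<le> r"
      using that(1) assms by (rule power2_le_imp_le[OF _ less_imp_le])
    then show ?thesis
      using that by (simp add: power_int_minus divide_inverse le_imp_inverse_le power_mono)
  qed
qed

lemma continuous_multiplier: "continuous_on {0..} (\<lambda>B. multiplier B n)"
proof -
  have nz: "chord B (int m) \<noteq> 0" if "0 \<le> B" "m \<in> {1..9}" for B and m :: nat
  proof -
    have "\<not> 10 dvd int m"
      using that(2) by (auto dest: zdvd_imp_le)
    then show ?thesis
      using chord_pos[OF that(1)] by (metis less_irrefl)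
  qed
  have "continuous_on {0..} (\<lambda>B. chord B m)" for m
    unfolding chord_def by (intro continuous_intros)
  then show ?thesis
    unfolding multiplier_def using nz by (intro continuous_intros) auto
qed

text \<open>By \<open>multiplier_values\<close>, \<open>D\<^sub>2\<close> decreases in the pair sum over \<open>m = 1, 4\<close> and increases in the one over
  \<open>m = 2, 3\<close>, so each endpoint needs only one-sided bounds for each distance.  The value at 4.7 is less than
  \<open>0.0001\<close> in size, hence the four decimals.\<close>

lemma root_multiplier_2:
  obtains B where "4.7 < B" "B < 4.71" "multiplier B 2 = 0"
proof -
  have neg: "multiplier 4.7 2 < 0"
  proof -
    have nonneg: "0 \<le> (4.7 :: real)"
      by simp
    have "(chord 4.7 1)\<^sup>2 \<le> 2.6225\<^sup>2" "(chord 4.7 4)\<^sup>2 \<le> 3.1802\<^sup>2"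
      "4.2879\<^sup>2 \<le> (chord 4.7 2)\<^sup>2" "4.4297\<^sup>2 \<le> (chord 4.7 3)\<^sup>2"
      unfolding chord_power2[OF nonneg] unfolding power2_eq_square using cos_theta_bounds
      by (simp_all add: field_simps)
    then have "1 / 2.6225 ^ 3 \<le> chord 4.7 1 powi (-3)" "1 / 3.1802 ^ 3 \<le> chord 4.7 4 powi (-3)"
      "chord 4.7 2 powi (-3) \<le> 1 / 4.2879 ^ 3" "chord 4.7 3 powi (-3) \<le> 1 / 4.4297 ^ 3"
      by (intro inverse_cube_bounds chord_pos; simp)+
    then have A: "0.08653 \<le> chord 4.7 1 powi (-3) + chord 4.7 4 powi (-3)"
      and E: "chord 4.7 2 powi (-3) + chord 4.7 3 powi (-3) \<le> 0.02419"
      by (simp_all add: power3_eq_cube)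
    have "0.80901 * 0.08653 \<le> cos theta * (chord 4.7 1 powi (-3) + chord 4.7 4 powi (-3))"
      using A cos_theta_bounds by (intro mult_mono) auto
    moreover have "(2 * cos theta - 1) * (chord 4.7 2 powi (-3) + chord 4.7 3 powi (-3))
        \<le> 0.61804 * 0.02419"
      using E cos_theta_bounds by (intro mult_mono)
        (auto intro!: add_nonneg_nonneg zero_le_power_int less_imp_le[OF chord_pos])
    ultimately show ?thesis
      unfolding multiplier_values by simp
  qed
  have pos: "0 < multiplier 4.71 2"
  proof -
    have nonneg: "0 \<le> (4.71 :: real)"
      by simp
    have "2.625\<^sup>2 \<le> (chord 4.71 1)\<^sup>2" "3.1822\<^sup>2 \<le> (chord 4.71 4)\<^sup>2"
      "(chord 4.71 2)\<^sup>2 \<le> 4.2923\<^sup>2" "(chord 4.71 3)\<^sup>2 \<le> 4.4339\<^sup>2"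
      unfolding chord_power2[OF nonneg] unfolding power2_eq_square using cos_theta_bounds
      by (simp_all add: field_simps)
    then have "chord 4.71 1 powi (-3) \<le> 1 / 2.625 ^ 3" "chord 4.71 4 powi (-3) \<le> 1 / 3.1822 ^ 3"
      "1 / 4.2923 ^ 3 \<le> chord 4.71 2 powi (-3)" "1 / 4.4339 ^ 3 \<le> chord 4.71 3 powi (-3)"
      by (intro inverse_cube_bounds chord_pos; simp)+
    then have A: "chord 4.71 1 powi (-3) + chord 4.71 4 powi (-3) \<le> 0.08632"
      and E: "0.024117 \<le> chord 4.71 2 powi (-3) + chord 4.71 3 powi (-3)"
      by (simp_all add: power3_eq_cube)
    have "cos theta * (chord 4.71 1 powi (-3) + chord 4.71 4 powi (-3)) \<le> 0.80902 * 0.08632"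
      using A cos_theta_bounds by (intro mult_mono)
        (auto intro!: add_nonneg_nonneg zero_le_power_int less_imp_le[OF chord_pos])
    moreover have "0.61802 * 0.024117
        \<le> (2 * cos theta - 1) * (chord 4.71 2 powi (-3) + chord 4.71 3 powi (-3))"
      using E cos_theta_bounds by (intro mult_mono) auto
    ultimately show ?thesis
      unfolding multiplier_values by simp
  qed
  have "continuous_on {4.7..4.71} (\<lambda>B. multiplier B 2)"
    by (rule continuous_on_subset[OF continuous_multiplier]) auto
  then obtain B where "4.7 \<le> B" "B \<le> 4.71" "multiplier B 2 = 0"
    using IVT'[of "\<lambda>B. multiplier B 2" "4.7" 0 "4.71"] neg pos by auto
  moreover have "B \<noteq> 4.7" "B \<noteq> 4.71"
    using neg pos calculation(3) by (metis less_irrefl)+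
  ultimately have "4.7 < B" "B < 4.71"
    by linarith+
  then show ?thesis
    using \<open>multiplier B 2 = 0\<close> by (rule that)
qed

text \<open>Two decimals of each distance suffice here, because \<open>D\<^sub>0\<close> is about \<open>0.35\<close> and \<open>D\<^sub>1\<close> about \<open>0.14\<close>.\<close>

lemma multiplier_ratio_bounds:
  assumes B: "4.7 \<le> B" "B \<le> 4.71"
  shows "0 < multiplier B 0" "multiplier B 0 < 3 * multiplier B 1"
    "3 * multiplier B 1 < 2 * multiplier B 0"
proof -
  let ?c = "cos theta"
  define A where "A = chord B 1 powi (-3) + chord B 4 powi (-3)"
  define E where "E = chord B 2 powi (-3) + chord B 3 powi (-3)"
  have nonneg: "0 \<le> B"
    using B by simp
  have c2: "1.38 \<le> 3 - 2 * ?c" "3 - 2 * ?c \<le> 1.382" "1.809 \<le> 1 + ?c" "1 + ?c \<le> 1.81"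
    using cos_theta_bounds by auto
  have "4.7 * 1.38 \<le> B * (3 - 2 * ?c)" "B * (3 - 2 * ?c) \<le> 4.71 * 1.382"
    "4.7 * 1.809 \<le> B * (1 + ?c)" "B * (1 + ?c) \<le> 4.71 * 1.81"
    using B c2 by (intro mult_mono; simp)+
  then have
    "(chord B 1)\<^sup>2 \<le> 2.63\<^sup>2" "2.61\<^sup>2 \<le> (chord B 1)\<^sup>2"
    "(chord B 2)\<^sup>2 \<le> 4.3\<^sup>2" "4.28\<^sup>2 \<le> (chord B 2)\<^sup>2"
    "(chord B 3)\<^sup>2 \<le> 4.44\<^sup>2" "4.42\<^sup>2 \<le> (chord B 3)\<^sup>2"
    "(chord B 4)\<^sup>2 \<le> 3.19\<^sup>2" "3.17\<^sup>2 \<le> (chord B 4)\<^sup>2"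
    unfolding chord_power2[OF nonneg] unfolding power2_eq_square using cos_theta_bounds by simp_all
  then have
    "1 / 2.63 ^ 3 \<le> chord B 1 powi (-3)" "chord B 1 powi (-3) \<le> 1 / 2.61 ^ 3"
    "1 / 4.3 ^ 3 \<le> chord B 2 powi (-3)" "chord B 2 powi (-3) \<le> 1 / 4.28 ^ 3"
    "1 / 4.44 ^ 3 \<le> chord B 3 powi (-3)" "chord B 3 powi (-3) \<le> 1 / 4.42 ^ 3"
    "1 / 3.19 ^ 3 \<le> chord B 4 powi (-3)" "chord B 4 powi (-3) \<le> 1 / 3.17 ^ 3"
    using nonneg by (intro inverse_cube_bounds chord_pos; simp)+
  then have A: "0.085 \<le> A" "A \<le> 0.088" and E: "0.023 \<le> E" "E \<le> 0.025"
    by (simp_all add: A_def E_def power3_eq_cube)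
  \<comment> \<open>The two products are named so that linear arithmetic treats them as atoms.\<close>
  define P where "P = (2 * ?c - 1) * A"
  define Q where "Q = 2 * ?c * E"
  have "0.61 * 0.085 \<le> P" "P \<le> 0.62 * 0.088" "1.6 * 0.023 \<le> Q" "Q \<le> 1.62 * 0.025"
    unfolding P_def Q_def using A E cos_theta_bounds by (intro mult_mono; simp)+
  then show "0 < multiplier B 0" "multiplier B 0 < 3 * multiplier B 1"
    "3 * multiplier B 1 < 2 * multiplier B 0"
    using A E
    unfolding multiplier_values A_def[symmetric] E_def[symmetric] P_def[symmetric] Q_def[symmetric]
    by simp_all
qed

section \<open>The amplitudes and the conclusion\<close>

text \<open>With \<open>q = (b / a)\<^sup>2\<close>, division by \<open>a\<close> and \<open>b\<close> turns the system into \<open>6 = c D\<^sub>0 a\<^sup>2 (1 + 3q/2)\<close> and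
  \<open>6 = c D\<^sub>1 a\<^sup>2 (3 + 3q/4)\<close>.  Equating the two right-hand sides gives the formula for \<open>q\<close> below; the bounds
  \<open>q > 0\<close> and \<open>q < 1\<close> are \<open>D\<^sub>0 < 3 D\<^sub>1\<close> and \<open>3 D\<^sub>1 < 2 D\<^sub>0\<close>.\<close>

lemma amplitudes:
  fixes c D0 D1 :: real
  assumes c: "0 < c" and D: "0 < D0" "D0 < 3 * D1" "3 * D1 < 2 * D0"
  obtains a b where "b < a" "0 < b"
    "6 * a = c * D0 * (a ^ 3 + 3/2 * a * b\<^sup>2)"
    "6 * b = c * D1 * (3 * a\<^sup>2 * b + 3/4 * b ^ 3)"
proof -
  define q where "q = (3 * D1 - D0) / (3/2 * D0 - 3/4 * D1)"
  have den: "0 < 3/2 * D0 - 3/4 * D1"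
    using D by simp
  have q: "0 < q" "q < 1"
    using D den by (auto simp: q_def divide_simps)
  have "q * (3/2 * D0 - 3/4 * D1) = 3 * D1 - D0"
    unfolding q_def using den by simp
  then have bal: "D1 * (3 + 3/4 * q) = D0 * (1 + 3/2 * q)"
    by (simp add: algebra_simps)
  define a where "a = sqrt (6 / (c * D0 * (1 + 3/2 * q)))"
  define b where "b = sqrt q * a"
  have "0 < c * D0 * (1 + 3/2 * q)"
    using c D q by (intro mult_pos_pos) auto
  moreover have "0 < sqrt (6 / v)" "v * (sqrt (6 / v))\<^sup>2 = 6" if "0 < v" for v :: real
    using that by simp_all
  ultimately have a: "0 < a" and a2: "c * D0 * (1 + 3/2 * q) * a\<^sup>2 = 6"
    unfolding a_def by blast+
  have b2: "b\<^sup>2 = q * a\<^sup>2"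
    using q by (simp add: b_def power_mult_distrib)
  show ?thesis
  proof
    show "b < a" "0 < b"
      using a q by (auto simp: b_def)
    have "c * D0 * (a ^ 3 + 3/2 * a * b\<^sup>2) = (c * D0 * (1 + 3/2 * q) * a\<^sup>2) * a"
      unfolding b2 by (simp add: power2_eq_square power3_eq_cube algebra_simps)
    then show "6 * a = c * D0 * (a ^ 3 + 3/2 * a * b\<^sup>2)"
      unfolding a2 by simp
    have "c * D1 * (3 * a\<^sup>2 * b + 3/4 * b ^ 3) = c * D1 * (3 * a\<^sup>2 + 3/4 * b\<^sup>2) * b"
      by (simp add: power2_eq_square power3_eq_cube algebra_simps)
    also have "\<dots> = c * (D1 * (3 + 3/4 * q)) * a\<^sup>2 * b"
      unfolding b2 by (simp add: algebra_simps)
    also have "\<dots> = (c * D0 * (1 + 3/2 * q) * a\<^sup>2) * b"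
      unfolding bal by (simp add: mult_ac)
    finally show "6 * b = c * D1 * (3 * a\<^sup>2 * b + 3/4 * b ^ 3)"
      unfolding a2 by simp
  qed
qed

theorem propositionA2:
  shows "\<exists>B0::real. 4.7 < B0 \<and> B0 < 4.71 \<and>
    (\<exists>a b::real. a > b \<and> b > 0 \<and>
      (\<forall>t::real. \<forall>k\<in>{1..10::nat}.
         6 * xk a b k t
           = kappa * (\<Sum>j\<in>{1..10} - {k}. norm (z B0 j - z B0 k) powi (-3) * (xk a b j t) ^ 3)
         \<and> xk a b k t > 0))"
proof -
  obtain B where B: "4.7 < B" "B < 4.71" "multiplier B 2 = 0"
    by (rule root_multiplier_2)
  have nonneg: "0 \<le> B"
    using B by simp
  obtain a b where ab: "b < a" "0 < b"
    "6 * a = kappa * multiplier B 0 * (a ^ 3 + 3/2 * a * b\<^sup>2)"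
    "6 * b = kappa * multiplier B 1 * (3 * a\<^sup>2 * b + 3/4 * b ^ 3)"
    using amplitudes[OF kappa_pos] multiplier_ratio_bounds[of B] B by (metis less_imp_le)
  have "6 * xk a b k t
        = kappa * (\<Sum>j\<in>{1..10} - {k}. norm (z B j - z B k) powi (-3) * (xk a b j t) ^ 3)"
    if k: "k \<in> {1..10}" for k t
  proof -
    let ?\<phi> = "t + 2 * (real k - 1) * theta"
    have "kappa * (\<Sum>j\<in>{1..10} - {k}. norm (z B j - z B k) powi (-3) * (xk a b j t) ^ 3)
        = kappa * ((a ^ 3 + 3/2 * a * b\<^sup>2) * multiplier B 0
            + (3 * a\<^sup>2 * b + 3/4 * b ^ 3) * multiplier B 1 * cos ?\<phi>)"
      unfolding interaction_sum[OF nonneg k] convolution_cube multiplier_values(4) B(3) by simp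
    also have "\<dots> = kappa * multiplier B 0 * (a ^ 3 + 3/2 * a * b\<^sup>2)
        + kappa * multiplier B 1 * (3 * a\<^sup>2 * b + 3/4 * b ^ 3) * cos ?\<phi>"
      by (simp add: algebra_simps)
    also have "\<dots> = 6 * xk a b k t"
      unfolding ab(3,4)[symmetric] by (simp add: xk_def)
    finally show ?thesis ..
  qed
  moreover have "0 < xk a b k t" for k t
  proof -
    have "- b \<le> b * cos (t + 2 * (real k - 1) * theta)"
      using ab(2) cos_ge_minus_one[of "t + 2 * (real k - 1) * theta"]
        mult_left_mono[of "- 1" "cos (t + 2 * (real k - 1) * theta)" b] by simp
    then show ?thesis
      using ab(1) by (simp add: xk_def)
  qed
  ultimately show ?thesis
    using B ab(1,2) by blast
qed

end
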